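(* Let $i\in\{1,2\}$, $\varepsilon=(-1)^i$, let $\lambda_1,\lambda_2,\lambda_3,\lambda_4\in\mathbb{R}$ be not all zero, put $\delta=\lambda_1+\lambda_2+\lambda_3-\lambda_4$, and equip $\mathbb{E}_1^4$ with the density $e^{\lambda_1x^2+\lambda_2y^2+\lambda_3z^2+\lambda_4t^2}$. Suppose that $g(u)=u$. Then the timelike general rotational surfaces of first and second types $\mathcal{S}_i$ are weighted flat if and only if, up to parametrization, the meridian curves are determined by $c_1:x_1(u)=(f(u),0,u,0)$ (for $\mathcal{S}_1$) and $c_2:x_2(u)=(f(u),0,0,u)$ (for $\mathcal{S}_2$), where $f(u)$ is a solution to the following differential equations: for $\mathcal{S}_1$ $$\left(\arctan\left(f'(u)\right)\right)'=A_4$$ and for $\mathcal{S}_2$ $$\left(\log\left(\frac{1-f'(u)}{1+f'(u)}\right)\right)'=2A_4,$$ where $$A_4=-\frac{-2\delta\left((\beta u)^2+\varepsilon(\alpha f(u))^2\right)^2\left(-\varepsilon+f'(u)^2\right)-\varepsilon\alpha^2\beta^2\left(f(u)-uf'(u)\right)^2}{\left((\beta u)^2+\varepsilon(\alpha f(u))^2\right)\left(\alpha^2f(u)+u\beta^2f'(u)\right)}.$$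
   Context: $\mathbb{E}_1^4$ is $\mathbb{R}^4$ with coordinates $(x,y,z,t)$ and the metric $dx^2+dy^2+dz^2-dt^2$. Let $\alpha,\beta>0$ be constants, $J\subset\mathbb{R}$, $f,g:J\to\mathbb{R}$ smooth functions of $u$ (primes denote $d/du$), and $v\in[0,2\pi)$. First type: $\mathcal{S}_1: X_1(u,v)=(f\cos(\alpha v),f\sin(\alpha v),g\cosh(\beta v),g\sinh(\beta v))$ with $\alpha^2f^2-\beta^2g^2<0$ and $f'^2+g'^2>0$ on $J$; its meridian curve is $u\mapsto(f(u),0,g(u),0)$. Second type: $\mathcal{S}_2: X_2(u,v)=(f\cos(\alpha v),f\sin(\alpha v),g\sinh(\beta v),g\cosh(\beta v))$ with $f'^2-g'^2<0$ and $\alpha^2f^2+\beta^2g^2>0$ on $J$; its meridian curve is $u\mapsto(f(u),0,0,g(u))$. Both surfaces are timelike. With $\varepsilon=(-1)^i$, the Gaussian curvature of $\mathcal{S}_i$ is $$K^{\mathcal{S}_i}=\frac{\alpha^2\beta^2(gf'-fg')^2(-\varepsilon f'^2+g'^2)+\left(\varepsilon(\alpha f)^2+(\beta g)^2\right)(\alpha^2fg'+\beta^2gf')(f''g'-f'g'')}{\left((\alpha f)^2+\varepsilon(\beta g)^2\right)^2(-\varepsilon f'^2+g'^2)^2}.$$ For a density $e^\phi$ on $\mathbb{E}_1^4$, the weighted Gaussian curvature is $K_\phi^{\mathcal{S}_i}=K^{\mathcal{S}_i}-\Delta\phi$, where $\Delta$ is the Laplacian of $\mathbb{E}_1^4$,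 $\Delta\phi=\phi_{xx}+\phi_{yy}+\phi_{zz}-\phi_{tt}$; for the density above $\Delta\phi=2\delta$. The surface is weighted flat if $K_\phi^{\mathcal{S}_i}$ vanishes.
   Formalization: The formal theorem additionally assumes α²f(u)+uβ²f'(u) ≠ 0 on J, so that A_4 is defined; without it the claim fails, e.g. for S_2 with f=0, u>0, δ=0, which is weighted flat while A_4 is undefined. *)

theory Defs
  imports "HOL-Analysis.Analysis"
begin

section \<open>Minkowski 4-space\<close>

text \<open>The points of \<open>E\<^sub>1\<^sup>4\<close> are vectors of type \<^typ>\<open>real ^ 4\<close>; the components 1, 2, 3, 4 are
  the coordinates \<open>x, y, z, t\<close>.\<close>

definition mink :: "real ^ 4 \<Rightarrow> real ^ 4 \<Rightarrow> real" where
  "mink a b = a$1 * b$1 + a$2 * b$2 + a$3 * b$3 - a$4 * b$4"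

definition partial_deriv :: "4 \<Rightarrow> (real ^ 4 \<Rightarrow> real) \<Rightarrow> real ^ 4 \<Rightarrow> real" where
  "partial_deriv k \<phi> p = deriv (\<lambda>s. \<phi> (p + s *\<^sub>R axis k 1)) 0"

definition mink_laplacian :: "(real ^ 4 \<Rightarrow> real) \<Rightarrow> real ^ 4 \<Rightarrow> real" where
  "mink_laplacian \<phi> p =
     partial_deriv 1 (partial_deriv 1 \<phi>) p + partial_deriv 2 (partial_deriv 2 \<phi>) p
   + partial_deriv 3 (partial_deriv 3 \<phi>) p - partial_deriv 4 (partial_deriv 4 \<phi>) p"

definition quadratic_log_density :: "real \<Rightarrow> real \<Rightarrow> real \<Rightarrow> real \<Rightarrow> real ^ 4 \<Rightarrow> real" where
  "quadratic_log_density l1 l2 l3 l4 p =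
     l1 * (p$1)^2 + l2 * (p$2)^2 + l3 * (p$3)^2 + l4 * (p$4)^2"


section \<open>Gaussian curvature of parametrized surfaces\<close>

definition du :: "(real \<Rightarrow> real \<Rightarrow> real ^ 4) \<Rightarrow> real \<Rightarrow> real \<Rightarrow> real ^ 4" where
  "du X u v = vector_derivative (\<lambda>s. X s v) (at u)"

definition dv :: "(real \<Rightarrow> real \<Rightarrow> real ^ 4) \<Rightarrow> real \<Rightarrow> real \<Rightarrow> real ^ 4" where
  "dv X u v = vector_derivative (\<lambda>s. X u s) (at v)"

definition EE :: "(real \<Rightarrow> real \<Rightarrow> real ^ 4) \<Rightarrow> real \<Rightarrow> real \<Rightarrow> real" where
  "EE X u v = mink (du X u v) (du X u v)"

definition FF :: "(real \<Rightarrow> real \<Rightarrow> real ^ 4) \<Rightarrow> real \<Rightarrow> real \<Rightarrow> real" where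
  "FF X u v = mink (du X u v) (dv X u v)"

definition GG :: "(real \<Rightarrow> real \<Rightarrow> real ^ 4) \<Rightarrow> real \<Rightarrow> real \<Rightarrow> real" where
  "GG X u v = mink (dv X u v) (dv X u v)"

text \<open>The component of \<open>w\<close> that is \<^const>\<open>mink\<close>-orthogonal to both \<open>du X u v\<close> and \<open>dv X u v\<close>
  (for a nondegenerate tangent plane).\<close>

definition normal_part ::
  "(real \<Rightarrow> real \<Rightarrow> real ^ 4) \<Rightarrow> real \<Rightarrow> real \<Rightarrow> real ^ 4 \<Rightarrow> real ^ 4" where
  "normal_part X u v w =
     (let E = EE X u v; F = FF X u v; G = GG X u v;
          p = mink w (du X u v); q = mink w (dv X u v)
      in w - ((G * p - F * q) / (E * G - F^2)) *\<^sub>R du X u v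
           - ((E * q - F * p) / (E * G - F^2)) *\<^sub>R dv X u v)"

text \<open>The Gauss equation in a flat ambient space: the vectors \<open>a\<close>, \<open>b\<close>, \<open>c\<close> are the values of the
  second fundamental form on the coordinate tangent vectors. In an orthonormal normal frame
  \<open>N\<^sub>1, N\<^sub>2\<close> this is the sum over \<open>k\<close> of
  \<open>\<langle>N\<^sub>k,N\<^sub>k\<rangle> (b\<^sup>k\<^sub>1\<^sub>1 b\<^sup>k\<^sub>2\<^sub>2 - (b\<^sup>k\<^sub>1\<^sub>2)\<^sup>2) / (EG - F\<^sup>2)\<close>. For the rotational surfaces below, an explicit
  formula is given in \<open>gaussian_curvature_rot\<close>.\<close>

definition gaussian_curvature :: "(real \<Rightarrow> real \<Rightarrow> real ^ 4) \<Rightarrow> real \<Rightarrow> real \<Rightarrow> real" where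
  "gaussian_curvature X u v =
     (let a = normal_part X u v (du (du X) u v);
          b = normal_part X u v (dv (du X) u v);
          c = normal_part X u v (dv (dv X) u v)
      in (mink a c - mink b b) / (EE X u v * GG X u v - (FF X u v)^2))"

definition weighted_gaussian_curvature ::
  "(real ^ 4 \<Rightarrow> real) \<Rightarrow> (real \<Rightarrow> real \<Rightarrow> real ^ 4) \<Rightarrow> real \<Rightarrow> real \<Rightarrow> real" where
  "weighted_gaussian_curvature \<phi> X u v =
     gaussian_curvature X u v - mink_laplacian \<phi> (X u v)"

definition weighted_flat ::
  "(real ^ 4 \<Rightarrow> real) \<Rightarrow> (real \<Rightarrow> real \<Rightarrow> real ^ 4) \<Rightarrow> real set \<Rightarrow> bool" where
  "weighted_flat \<phi> X J \<longleftrightarrow>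
     (\<forall>u\<in>J. \<forall>v\<in>{0..<2 * pi}. weighted_gaussian_curvature \<phi> X u v = 0)"


section \<open>General rotational surfaces\<close>

definition smooth_fun_on :: "real set \<Rightarrow> (real \<Rightarrow> real) \<Rightarrow> bool" where
  "smooth_fun_on J f \<longleftrightarrow> (\<forall>n. \<forall>u\<in>J. ((deriv ^^ n) f) differentiable (at u))"

text \<open>In the following, \<open>i = 1\<close> is the first type and any other \<open>i\<close> (in use: \<open>i = 2\<close>) the
  second type.\<close>

definition rot_surface ::
  "nat \<Rightarrow> real \<Rightarrow> real \<Rightarrow> (real \<Rightarrow> real) \<Rightarrow> (real \<Rightarrow> real) \<Rightarrow> real \<Rightarrow> real \<Rightarrow> real ^ 4" where
  "rot_surface i \<alpha> \<beta> f g u v =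
     (if i = 1
      then vector [f u * cos (\<alpha> * v), f u * sin (\<alpha> * v), g u * cosh (\<beta> * v), g u * sinh (\<beta> * v)]
      else vector [f u * cos (\<alpha> * v), f u * sin (\<alpha> * v), g u * sinh (\<beta> * v), g u * cosh (\<beta> * v)])"

definition meridian :: "nat \<Rightarrow> (real \<Rightarrow> real) \<Rightarrow> (real \<Rightarrow> real) \<Rightarrow> real \<Rightarrow> real ^ 4" where
  "meridian i f g u = (if i = 1 then vector [f u, 0, g u, 0] else vector [f u, 0, 0, g u])"

definition timelike_rot_data ::
  "nat \<Rightarrow> real \<Rightarrow> real \<Rightarrow> (real \<Rightarrow> real) \<Rightarrow> (real \<Rightarrow> real) \<Rightarrow> real set \<Rightarrow> bool" where
  "timelike_rot_data i \<alpha> \<beta> f g J \<longleftrightarrow>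
     open J \<and> smooth_fun_on J f \<and> smooth_fun_on J g \<and>
     (\<forall>u\<in>J. if i = 1
        then \<alpha>^2 * (f u)^2 - \<beta>^2 * (g u)^2 < 0 \<and> (deriv f u)^2 + (deriv g u)^2 > 0
        else (deriv f u)^2 - (deriv g u)^2 < 0 \<and> \<alpha>^2 * (f u)^2 + \<beta>^2 * (g u)^2 > 0)"

definition same_up_to_parametrization ::
  "(real \<Rightarrow> real ^ 4) \<Rightarrow> real set \<Rightarrow> (real \<Rightarrow> real ^ 4) \<Rightarrow> real set \<Rightarrow> bool" where
  "same_up_to_parametrization c J d I \<longleftrightarrow>
     (\<exists>\<psi>. bij_betw \<psi> I J \<and> smooth_fun_on I \<psi> \<and> (\<forall>s\<in>I. deriv \<psi> s \<noteq> 0) \<and>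
          (\<forall>s\<in>I. c (\<psi> s) = d s))"

text \<open>The right-hand side is meaningful only where \<open>\<alpha>\<^sup>2 f u + u \<beta>\<^sup>2 f' u \<noteq> 0\<close>, since HOL division
  totalizes \<open>x / 0 = 0\<close>; the other denominator factor is nonzero for timelike surfaces with
  \<open>g u = u\<close>.\<close>

definition A4 :: "nat \<Rightarrow> real \<Rightarrow> real \<Rightarrow> real \<Rightarrow> (real \<Rightarrow> real) \<Rightarrow> real \<Rightarrow> real" where
  "A4 i \<alpha> \<beta> \<delta> f u =
     (let \<epsilon> = (-1)^i in
      - ((- 2 * \<delta> * ((\<beta> * u)^2 + \<epsilon> * (\<alpha> * f u)^2)^2 * (- \<epsilon> + (deriv f u)^2)
           - \<epsilon> * \<alpha>^2 * \<beta>^2 * (f u - u * deriv f u)^2)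
         / (((\<beta> * u)^2 + \<epsilon> * (\<alpha> * f u)^2) * (\<alpha>^2 * f u + u * \<beta>^2 * deriv f u))))"

definition solves_meridian_ode ::
  "nat \<Rightarrow> real \<Rightarrow> real \<Rightarrow> real \<Rightarrow> (real \<Rightarrow> real) \<Rightarrow> real set \<Rightarrow> bool" where
  "solves_meridian_ode i \<alpha> \<beta> \<delta> f J \<longleftrightarrow>
     (\<forall>u\<in>J. if i = 1
        then ((\<lambda>s. arctan (deriv f s)) has_real_derivative A4 i \<alpha> \<beta> \<delta> f u) (at u)
        else ((\<lambda>s. ln ((1 - deriv f s) / (1 + deriv f s)))
                has_real_derivative 2 * A4 i \<alpha> \<beta> \<delta> f u) (at u))"


section \<open>The explicit curvature formula\<close>

lemma vector_4 [simp]: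
  "(vector [a, b, c, d] :: ('a::zero)^4) $ 1 = a"
  "(vector [a, b, c, d] :: ('a::zero)^4) $ 2 = b"
  "(vector [a, b, c, d] :: ('a::zero)^4) $ 3 = c"
  "(vector [a, b, c, d] :: ('a::zero)^4) $ 4 = d"
  unfolding vector_def by auto

lemma hvd_vector4:
  assumes "(a has_real_derivative a') (at x)" "(b has_real_derivative b') (at x)"
    "(c has_real_derivative c') (at x)" "(d has_real_derivative d') (at x)"
  shows "((\<lambda>s. vector [a s, b s, c s, d s] :: real^4) has_vector_derivative vector [a', b', c', d']) (at x)"
proof -
  have *: "(vector [p, q, r, t] :: real^4) =
      p *\<^sub>R axis 1 1 + q *\<^sub>R axis 2 1 + r *\<^sub>R axis 3 1 + t *\<^sub>R axis 4 1" for p q r t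
    by (simp add: vec_eq_iff forall_4 axis_def)
  show ?thesis
    unfolding * using assms
    by (auto intro!: derivative_eq_intros simp: has_real_derivative_iff_has_vector_derivative)
qed

lemma smooth_fun_on_DERIV:
  assumes "smooth_fun_on J f" "u \<in> J"
  shows "(f has_real_derivative deriv f u) (at u)"
    and "(deriv f has_real_derivative deriv (deriv f) u) (at u)"
proof -
  have "((deriv ^^ 0) f) differentiable (at u)" "((deriv ^^ 1) f) differentiable (at u)"
    using assms unfolding smooth_fun_on_def by blast+
  then show "(f has_real_derivative deriv f u) (at u)"
    and "(deriv f has_real_derivative deriv (deriv f) u) (at u)"
    by (simp_all add: DERIV_deriv_iff_real_differentiable)
qed

lemma rot_surface_derivs:
  fixes \<alpha> \<beta> :: real and i :: nat
  assumes J: "open J" "smooth_fun_on J f" "smooth_fun_on J g" and u: "u \<in> J"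
  defines "C \<equiv> \<lambda>v. if i = 1 then cosh (\<beta> * v) else sinh (\<beta> * v)"
  defines "S \<equiv> \<lambda>v. if i = 1 then sinh (\<beta> * v) else cosh (\<beta> * v)"
  defines "X \<equiv> rot_surface i \<alpha> \<beta> f g"
  shows "du X u v = vector [deriv f u * cos (\<alpha> * v), deriv f u * sin (\<alpha> * v), deriv g u * C v, deriv g u * S v]"
    and "dv X u v = vector [- \<alpha> * f u * sin (\<alpha> * v), \<alpha> * f u * cos (\<alpha> * v), \<beta> * g u * S v, \<beta> * g u * C v]"
    and "du (du X) u v = vector [deriv (deriv f) u * cos (\<alpha> * v), deriv (deriv f) u * sin (\<alpha> * v),
           deriv (deriv g) u * C v, deriv (deriv g) u * S v]"
    and "dv (du X) u v = vector [- \<alpha> * deriv f u * sin (\<alpha> * v), \<alpha> * deriv f u * cos (\<alpha> * v),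
           \<beta> * deriv g u * S v, \<beta> * deriv g u * C v]"
    and "dv (dv X) u v = vector [- (\<alpha>^2) * f u * cos (\<alpha> * v), - (\<alpha>^2) * f u * sin (\<alpha> * v),
           \<beta>^2 * g u * C v, \<beta>^2 * g u * S v]"
proof -
  have X: "X = (\<lambda>u v. vector [f u * cos (\<alpha> * v), f u * sin (\<alpha> * v), g u * C v, g u * S v])"
    by (auto simp: X_def rot_surface_def C_def S_def fun_eq_iff)
  have C: "(C has_real_derivative \<beta> * S v) (at v)" for v
    unfolding C_def S_def by (cases "i = 1") (auto intro!: derivative_eq_intros)
  have S: "(S has_real_derivative \<beta> * C v) (at v)" for v
    unfolding C_def S_def by (cases "i = 1") (auto intro!: derivative_eq_intros)
  have f: "(f has_real_derivative deriv f w) (at w)"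
      "(deriv f has_real_derivative deriv (deriv f) w) (at w)"
      "(g has_real_derivative deriv g w) (at w)"
      "(deriv g has_real_derivative deriv (deriv g) w) (at w)" if "w \<in> J" for w
    using smooth_fun_on_DERIV J that by blast+
  have 1: "du X w v = vector [deriv f w * cos (\<alpha> * v), deriv f w * sin (\<alpha> * v), deriv g w * C v, deriv g w * S v]"
    if "w \<in> J" for w v
    unfolding du_def X
    by (rule vector_derivative_at, rule hvd_vector4) (auto intro!: derivative_eq_intros f that)
  have 2: "dv X w v = vector [- \<alpha> * f w * sin (\<alpha> * v), \<alpha> * f w * cos (\<alpha> * v), \<beta> * g w * S v, \<beta> * g w * C v]" for w v
    unfolding dv_def X
    by (rule vector_derivative_at, rule hvd_vector4) (auto intro!: derivative_eq_intros C S)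
  show "du X u v = vector [deriv f u * cos (\<alpha> * v), deriv f u * sin (\<alpha> * v), deriv g u * C v, deriv g u * S v]"
    by (rule 1[OF u])
  show "dv X u v = vector [- \<alpha> * f u * sin (\<alpha> * v), \<alpha> * f u * cos (\<alpha> * v), \<beta> * g u * S v, \<beta> * g u * C v]"
    by (rule 2)
  have "((\<lambda>w. vector [deriv f w * cos (\<alpha> * v), deriv f w * sin (\<alpha> * v), deriv g w * C v, deriv g w * S v] :: real^4)
      has_vector_derivative vector [deriv (deriv f) u * cos (\<alpha> * v), deriv (deriv f) u * sin (\<alpha> * v),
           deriv (deriv g) u * C v, deriv (deriv g) u * S v]) (at u)"
    by (rule hvd_vector4) (auto intro!: derivative_eq_intros f u)
  then have "((\<lambda>w. du X w v) has_vector_derivative vector [deriv (deriv f) u * cos (\<alpha> * v), deriv (deriv f) u * sin (\<alpha> * v),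
           deriv (deriv g) u * C v, deriv (deriv g) u * S v]) (at u)"
    by (rule has_vector_derivative_transform_within_open[OF _ J(1) u]) (simp add: 1)
  then show "du (du X) u v = vector [deriv (deriv f) u * cos (\<alpha> * v), deriv (deriv f) u * sin (\<alpha> * v),
           deriv (deriv g) u * C v, deriv (deriv g) u * S v]"
    unfolding du_def[of "du X"] by (rule vector_derivative_at)
  show "dv (du X) u v = vector [- \<alpha> * deriv f u * sin (\<alpha> * v), \<alpha> * deriv f u * cos (\<alpha> * v),
           \<beta> * deriv g u * S v, \<beta> * deriv g u * C v]"
    unfolding dv_def 1[OF u]
    by (rule vector_derivative_at, rule hvd_vector4) (auto intro!: derivative_eq_intros C S)
  show "dv (dv X) u v = vector [- (\<alpha>^2) * f u * cos (\<alpha> * v), - (\<alpha>^2) * f u * sin (\<alpha> * v),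
           \<beta>^2 * g u * C v, \<beta>^2 * g u * S v]"
    unfolding dv_def[of "dv X"] 2
    by (rule vector_derivative_at, rule hvd_vector4)
      (auto intro!: derivative_eq_intros C S simp: power2_eq_square)
qed

lemma mink_diff_scale:
  "mink (a - p *\<^sub>R x - q *\<^sub>R y) (b - r *\<^sub>R x - s *\<^sub>R y) =
    mink a b - r * mink a x - s * mink a y - p * mink b x - q * mink b y
    + p * r * mink x x + (p * s + q * r) * mink x y + q * s * mink y y"
  by (simp add: mink_def algebra_simps)

lemma gaussian_curvature_orthogonal:
  assumes F: "FF X u v = 0" and E: "EE X u v \<noteq> 0" and G: "GG X u v \<noteq> 0"
  defines "E \<equiv> EE X u v" and "G \<equiv> GG X u v"
  defines "Xu \<equiv> du X u v" and "Xv \<equiv> dv X u v"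
  defines "Xuu \<equiv> du (du X) u v" and "Xuv \<equiv> dv (du X) u v" and "Xvv \<equiv> dv (dv X) u v"
  shows "gaussian_curvature X u v =
     (mink Xuu Xvv - mink Xuu Xu * mink Xvv Xu / E - mink Xuu Xv * mink Xvv Xv / G
      - (mink Xuv Xuv - (mink Xuv Xu)^2 / E - (mink Xuv Xv)^2 / G)) / (E * G)"
proof -
  have m: "mink Xu Xu = E" "mink Xv Xv = G" "mink Xu Xv = 0"
    using F by (simp_all add: EE_def FF_def GG_def E_def G_def Xu_def Xv_def)
  have np: "normal_part X u v w = w - (mink w Xu / E) *\<^sub>R Xu - (mink w Xv / G) *\<^sub>R Xv" for w
    using F E G by (simp add: normal_part_def Let_def E_def G_def Xu_def Xv_def)
  have pr: "mink (normal_part X u v w) (normal_part X u v w') =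
      mink w w' - mink w Xu * mink w' Xu / E - mink w Xv * mink w' Xv / G" for w w'
    unfolding np mink_diff_scale m using E G
    by (simp add: E_def[symmetric] G_def[symmetric] algebra_simps)
  show ?thesis
    using F by (simp add: gaussian_curvature_def Let_def pr E_def[symmetric] G_def[symmetric]
      Xuu_def Xuv_def Xvv_def power2_eq_square)
qed

lemma gaussian_curvature_rot:
  assumes i: "i \<in> {1, 2}" and data: "timelike_rot_data i \<alpha> \<beta> f g J" and u: "u \<in> J"
    and \<epsilon>: "\<epsilon> = (-1)^i"
  shows "gaussian_curvature (rot_surface i \<alpha> \<beta> f g) u v =
    (\<alpha>^2 * \<beta>^2 * (g u * deriv f u - f u * deriv g u)^2 * (- \<epsilon> * (deriv f u)^2 + (deriv g u)^2)
      + (\<epsilon> * (\<alpha> * f u)^2 + (\<beta> * g u)^2) * (\<alpha>^2 * f u * deriv g u + \<beta>^2 * g u * deriv f u)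
          * (deriv (deriv f) u * deriv g u - deriv f u * deriv (deriv g) u))
    / (((\<alpha> * f u)^2 + \<epsilon> * (\<beta> * g u)^2)^2 * (- \<epsilon> * (deriv f u)^2 + (deriv g u)^2)^2)"
proof -
  define X where "X = rot_surface i \<alpha> \<beta> f g"
  define c where "c = cos (\<alpha> * v)"
  define s where "s = sin (\<alpha> * v)"
  define C where "C = (if i = 1 then cosh (\<beta> * v) else sinh (\<beta> * v))"
  define S where "S = (if i = 1 then sinh (\<beta> * v) else cosh (\<beta> * v))"
  have J: "open J" "smooth_fun_on J f" "smooth_fun_on J g"
    using data by (auto simp: timelike_rot_data_def)
  note D = rot_surface_derivs[OF J u, of i \<alpha> \<beta> v, folded X_def c_def s_def C_def S_def]
  have cs: "c^2 = 1 - s^2" by (simp add: c_def s_def cos_squared_eq)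
  have CS: "C^2 = S^2 - \<epsilon>"
    using i by (auto simp: C_def S_def \<epsilon> cosh_square_eq)
  have ee: "\<epsilon>^2 = 1" and \<epsilon>12: "i = 1 \<and> \<epsilon> = -1 \<or> i = 2 \<and> \<epsilon> = 1" using i by (auto simp: \<epsilon>)
  define F0 F1 F2 G0 G1 G2 where defs: "F0 = f u" "F1 = deriv f u" "F2 = deriv (deriv f) u"
    "G0 = g u" "G1 = deriv g u" "G2 = deriv (deriv g) u"
  define E where "E = F1^2 - \<epsilon> * G1^2"
  define G where "G = \<alpha>^2 * F0^2 + \<epsilon> * \<beta>^2 * G0^2"
  note D' = D[folded defs]
  have mv: "mink (vector [a1, a2, a3, a4]) (vector [b1, b2, b3, b4]) = a1 * b1 + a2 * b2 + a3 * b3 - a4 * b4"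
    for a1 a2 a3 a4 b1 b2 b3 b4 by (simp add: mink_def)
  have I0: "FF X u v = 0" "mink (du (du X) u v) (dv X u v) = 0" "mink (dv (du X) u v) (du X u v) = 0"
    unfolding FF_def D' mv by (simp_all add: algebra_simps)
  have I: "EE X u v = E" "GG X u v = G"
    "mink (du (du X) u v) (dv (dv X) u v) = - (\<alpha>^2) * F0 * F2 - \<epsilon> * \<beta>^2 * G0 * G2"
    "mink (du (du X) u v) (du X u v) = F1 * F2 - \<epsilon> * G1 * G2"
    "mink (dv (dv X) u v) (du X u v) = - (\<alpha>^2) * F0 * F1 - \<epsilon> * \<beta>^2 * G0 * G1"
    "mink (dv (du X) u v) (dv (du X) u v) = \<alpha>^2 * F1^2 + \<epsilon> * \<beta>^2 * G1^2"
    "mink (dv (du X) u v) (dv X u v) = \<alpha>^2 * F0 * F1 + \<epsilon> * \<beta>^2 * G0 * G1"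
    unfolding EE_def GG_def D' mv E_def G_def
    using cs CS by algebra+
  have E: "E \<noteq> 0" and G: "G \<noteq> 0"
    using data u \<epsilon>12 by (auto simp: timelike_rot_data_def E_def G_def defs algebra_simps split: if_splits)
  have "gaussian_curvature X u v =
     ((- (\<alpha>^2) * F0 * F2 - \<epsilon> * \<beta>^2 * G0 * G2)
        - (F1 * F2 - \<epsilon> * G1 * G2) * (- (\<alpha>^2) * F0 * F1 - \<epsilon> * \<beta>^2 * G0 * G1) / E
      - ((\<alpha>^2 * F1^2 + \<epsilon> * \<beta>^2 * G1^2) - (\<alpha>^2 * F0 * F1 + \<epsilon> * \<beta>^2 * G0 * G1)^2 / G)) / (E * G)"
    using gaussian_curvature_orthogonal[of X u v] E G by (simp add: I I0)
  also have "\<dots> = ((- (\<alpha>^2) * F0 * F2 - \<epsilon> * \<beta>^2 * G0 * G2) * E * G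
        - (F1 * F2 - \<epsilon> * G1 * G2) * (- (\<alpha>^2) * F0 * F1 - \<epsilon> * \<beta>^2 * G0 * G1) * G
      - (\<alpha>^2 * F1^2 + \<epsilon> * \<beta>^2 * G1^2) * E * G + (\<alpha>^2 * F0 * F1 + \<epsilon> * \<beta>^2 * G0 * G1)^2 * E) / (G^2 * E^2)"
    (is "(?p - ?q / E - (?w - ?t / G)) / _ = ?n / _")
    using E G by (simp add: divide_simps power2_eq_square) algebra
  also have "?n = \<alpha>^2 * \<beta>^2 * (G0 * F1 - F0 * G1)^2 * (- \<epsilon> * F1^2 + G1^2)
      + (\<epsilon> * (\<alpha> * F0)^2 + (\<beta> * G0)^2) * (\<alpha>^2 * F0 * G1 + \<beta>^2 * G0 * F1) * (F2 * G1 - F1 * G2)"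
    unfolding E_def G_def using ee by algebra
  also have "G^2 * E^2 = ((\<alpha> * F0)^2 + \<epsilon> * (\<beta> * G0)^2)^2 * (- \<epsilon> * F1^2 + G1^2)^2"
    unfolding E_def G_def using ee by algebra
  finally show ?thesis unfolding X_def defs .
qed

lemma mink_laplacian_quadratic:
  "mink_laplacian (quadratic_log_density l1 l2 l3 l4) p = 2 * (l1 + l2 + l3 - l4)"
proof -
  define q where "q = quadratic_log_density l1 l2 l3 l4"
  have *: "((\<lambda>s. q (p + s *\<^sub>R axis k 1)) has_real_derivative
      2 * l1 * p$1 * axis k 1 $ 1 + 2 * l2 * p$2 * axis k 1 $ 2
      + 2 * l3 * p$3 * axis k 1 $ 3 + 2 * l4 * p$4 * axis k 1 $ 4) (at 0)" for p k
    unfolding q_def quadratic_log_density_def by (auto intro!: derivative_eq_intros)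
  have 1: "partial_deriv k q = (\<lambda>p. 2 * l1 * p$1 * axis k 1 $ 1 + 2 * l2 * p$2 * axis k 1 $ 2
      + 2 * l3 * p$3 * axis k 1 $ 3 + 2 * l4 * p$4 * axis k 1 $ 4)" for k
    unfolding partial_deriv_def using DERIV_imp_deriv[OF *] by (simp add: fun_eq_iff)
  have 2: "partial_deriv k (\<lambda>p. a * p$k) p = a" for a k p
    unfolding partial_deriv_def
    by (rule DERIV_imp_deriv) (auto intro!: derivative_eq_intros)
  show ?thesis
    unfolding q_def[symmetric] mink_laplacian_def
    by (simp add: 1 axis_def 2)
qed

end

theory Submission
  imports Defs
begin

text \<open>Why the theorem holds: the Laplacian of the quadratic log-density is the constant
  \<open>2 \<delta>\<close>, so weighted flatness says that the Gaussian curvature equals \<open>2 \<delta>\<close> everywhere. The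
  rotational symmetry makes this curvature independent of \<open>v\<close>. With \<open>g u = u\<close>, and with
  \<open>P = (\<beta> u)\<^sup>2 + \<epsilon> (\<alpha> f)\<^sup>2\<close>, \<open>W = 1 - \<epsilon> f'\<^sup>2\<close> and \<open>D = \<alpha>\<^sup>2 f + u \<beta>\<^sup>2 f'\<close>, the curvature equation
  \<open>K = 2 \<delta>\<close> reads
  \<open>\<alpha>\<^sup>2 \<beta>\<^sup>2 (u f' - f)\<^sup>2 W + P D f'' = 2 \<delta> P\<^sup>2 W\<^sup>2\<close>.
  It is linear in \<open>f''\<close>. The causal conditions make \<open>P\<close> and \<open>W\<close> positive, and \<open>D\<close> does not
  vanish, so the equation can be solved for the quotient \<open>f'' / W\<close>; the solved form is
  \<open>f'' / W = - \<epsilon> A\<^sub>4\<close> (\<open>curvature_equation_iff_A4\<close>).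

  The quotient \<open>f'' / W\<close> is a total derivative. For \<open>\<epsilon> = -1\<close> the direction of the meridian is a
  Euclidean angle and \<open>f'' / (1 + f'\<^sup>2) = (arctan f')'\<close>; for \<open>\<epsilon> = 1\<close> it is a hyperbolic angle
  (rapidity) and \<open>-2 f'' / (1 - f'\<^sup>2) = (ln ((1 - f') / (1 + f')))'\<close>. Both types of surface
  are thus the same computation (\<open>solves_meridian_ode_iff\<close>).

  Finally, the meridian already has the required graph form, so the clause about
  reparametrization is witnessed by the identity.\<close>

text \<open>The invariant for the induction is that iterated derivatives of the identity stay affine.\<close>

lemma smooth_fun_on_ident: "smooth_fun_on I (\<lambda>x. x)"
proof -
  have "\<exists>a b. (deriv ^^ n) (\<lambda>x::real. x) = (\<lambda>x. a * x + b)" for n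
  proof (induction n)
    case 0
    show ?case by (intro exI[of _ 1] exI[of _ 0]) simp
  next
    case (Suc n)
    then obtain a b where ab: "(deriv ^^ n) (\<lambda>x::real. x) = (\<lambda>x. a * x + b)" by blast
    have "(deriv ^^ Suc n) (\<lambda>x::real. x) = (\<lambda>x. 0 * x + a)"
      by (auto simp: ab fun_eq_iff intro!: DERIV_imp_deriv derivative_eq_intros)
    then show ?case by blast
  qed
  moreover have "(\<lambda>x::real. a * x + b) differentiable (at u)" for a b u
    by (intro derivative_intros)
  ultimately show ?thesis unfolding smooth_fun_on_def by metis
qed

lemma same_up_to_parametrization_cong:
  assumes "\<And>s. s \<in> I \<Longrightarrow> c s = d s"
  shows "same_up_to_parametrization c I d I"
  unfolding same_up_to_parametrization_def
  using assms smooth_fun_on_ident by (intro exI[of _ "\<lambda>x. x"]) (auto simp: bij_betw_def)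

lemma deriv_cong_on_open:
  assumes "open J" "u \<in> J" "\<And>x. x \<in> J \<Longrightarrow> g x = h x"
  shows "deriv g u = deriv h u"
  using assms by (intro deriv_cong_ev) (auto simp: eventually_nhds)

lemma deriv_ident_on_open:
  fixes g :: "real \<Rightarrow> real"
  assumes J: "open J" and g: "\<And>x. x \<in> J \<Longrightarrow> g x = x" and u: "u \<in> J"
  shows "deriv g u = 1" and "deriv (deriv g) u = 0"
proof -
  have 1: "deriv g w = 1" if "w \<in> J" for w
    using deriv_cong_on_open[OF J that, of g "\<lambda>x. x"] g by simp
  show "deriv g u = 1" by (rule 1[OF u])
  show "deriv (deriv g) u = 0"
    using deriv_cong_on_open[OF J u, of "deriv g" "\<lambda>_. 1"] 1 by simp
qed

lemma timelike_graph_signs: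
  assumes "i \<in> {1, 2}" and "timelike_rot_data i \<alpha> \<beta> f g J"
    and "\<forall>u\<in>J. g u = u" and "u \<in> J" and "\<epsilon> = (-1)^i"
  shows "(\<beta> * u)^2 + \<epsilon> * (\<alpha> * f u)^2 > 0" and "1 - \<epsilon> * (deriv f u)^2 > 0"
proof -
  have "open J" using assms by (simp add: timelike_rot_data_def)
  then have "deriv g u = 1" using assms by (intro deriv_ident_on_open(1)[of J]) auto
  then show "(\<beta> * u)^2 + \<epsilon> * (\<alpha> * f u)^2 > 0" and "1 - \<epsilon> * (deriv f u)^2 > 0"
    using assms by (auto simp: timelike_rot_data_def power_mult_distrib algebra_simps
        intro: add_pos_nonneg split: if_splits)
qed

text \<open>The curvature is a function of \<open>u\<close> alone and the Laplacian term is constant, so the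
  quantifier over the nonempty range of \<open>v\<close> disappears. The equation has been multiplied by
  the denominator \<open>P\<^sup>2 W\<^sup>2\<close> of the curvature, which is nonzero by the causal conditions.\<close>

lemma weighted_flat_graph_iff:
  assumes i: "i \<in> {1, 2}" and data: "timelike_rot_data i \<alpha> \<beta> f g J"
    and g: "\<forall>u\<in>J. g u = u" and \<epsilon>: "\<epsilon> = (-1)^i" and \<delta>: "\<delta> = l1 + l2 + l3 - l4"
  shows "weighted_flat (quadratic_log_density l1 l2 l3 l4) (rot_surface i \<alpha> \<beta> f g) J \<longleftrightarrow>
    (\<forall>u\<in>J. \<alpha>^2 * \<beta>^2 * (u * deriv f u - f u)^2 * (1 - \<epsilon> * (deriv f u)^2)
        + ((\<beta> * u)^2 + \<epsilon> * (\<alpha> * f u)^2) * (\<alpha>^2 * f u + u * \<beta>^2 * deriv f u) * deriv (deriv f) u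
      = 2 * \<delta> * ((\<beta> * u)^2 + \<epsilon> * (\<alpha> * f u)^2)^2 * (1 - \<epsilon> * (deriv f u)^2)^2)"
proof -
  have "weighted_gaussian_curvature (quadratic_log_density l1 l2 l3 l4)
        (rot_surface i \<alpha> \<beta> f g) u v = 0 \<longleftrightarrow>
      \<alpha>^2 * \<beta>^2 * (u * deriv f u - f u)^2 * (1 - \<epsilon> * (deriv f u)^2)
        + ((\<beta> * u)^2 + \<epsilon> * (\<alpha> * f u)^2) * (\<alpha>^2 * f u + u * \<beta>^2 * deriv f u) * deriv (deriv f) u
      = 2 * \<delta> * ((\<beta> * u)^2 + \<epsilon> * (\<alpha> * f u)^2)^2 * (1 - \<epsilon> * (deriv f u)^2)^2"
    (is "_ \<longleftrightarrow> ?N = 2 * \<delta> * ?P^2 * ?W^2") if u: "u \<in> J" for u v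
  proof -
    have "open J" using data by (simp add: timelike_rot_data_def)
    then have dg: "g u = u" "deriv g u = 1" "deriv (deriv g) u = 0"
      using deriv_ident_on_open[of J g u] g u by auto
    have nz: "?P \<noteq> 0" "?W \<noteq> 0"
      using timelike_graph_signs[OF i data g u \<epsilon>] by simp_all
    have "\<epsilon>^2 = 1" using i by (auto simp: \<epsilon>)
    then have den: "((\<alpha> * f u)^2 + \<epsilon> * (\<beta> * u)^2)^2 = ?P^2" by algebra
    have "gaussian_curvature (rot_surface i \<alpha> \<beta> f g) u v = ?N / (?P^2 * ?W^2)"
      unfolding gaussian_curvature_rot[OF i data u \<epsilon>] dg den[symmetric]
      by (simp add: algebra_simps)
    then show ?thesis
      using nz by (simp add: weighted_gaussian_curvature_def mink_laplacian_quadratic \<delta>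
          divide_eq_eq mult.assoc)
  qed
  moreover have "(0::real) \<in> {0..<2 * pi}" by simp
  ultimately show ?thesis unfolding weighted_flat_def by blast
qed

text \<open>The curvature equation is linear in \<open>f''\<close> with leading coefficient \<open>P D\<close>, so nonvanishing
  of \<open>P\<close>, \<open>W\<close> and \<open>D\<close> is what permits solving it. The sign \<open>- \<epsilon>\<close> appears because \<open>A4\<close> is
  written with the factor \<open>f'\<^sup>2 - \<epsilon> = - \<epsilon> W\<close>.\<close>

lemma curvature_equation_iff_A4:
  assumes \<epsilon>: "\<epsilon> = (-1)^i"
    and P: "(\<beta> * u)^2 + \<epsilon> * (\<alpha> * f u)^2 \<noteq> 0" and W: "1 - \<epsilon> * (deriv f u)^2 \<noteq> 0"
    and D: "\<alpha>^2 * f u + u * \<beta>^2 * deriv f u \<noteq> 0"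
  shows "\<alpha>^2 * \<beta>^2 * (u * deriv f u - f u)^2 * (1 - \<epsilon> * (deriv f u)^2)
        + ((\<beta> * u)^2 + \<epsilon> * (\<alpha> * f u)^2) * (\<alpha>^2 * f u + u * \<beta>^2 * deriv f u) * deriv (deriv f) u
      = 2 * \<delta> * ((\<beta> * u)^2 + \<epsilon> * (\<alpha> * f u)^2)^2 * (1 - \<epsilon> * (deriv f u)^2)^2
    \<longleftrightarrow> deriv (deriv f) u / (1 - \<epsilon> * (deriv f u)^2) = - \<epsilon> * A4 i \<alpha> \<beta> \<delta> f u"
proof -
  define p where "p = (\<beta> * u)^2 + \<epsilon> * (\<alpha> * f u)^2"
  define w where "w = 1 - \<epsilon> * (deriv f u)^2"
  define d where "d = \<alpha>^2 * f u + u * \<beta>^2 * deriv f u"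
  define q where "q = \<alpha>^2 * \<beta>^2 * (u * deriv f u - f u)^2"
  define s where "s = deriv (deriv f) u"
  have nz: "p \<noteq> 0" "w \<noteq> 0" "d \<noteq> 0" using P W D by (simp_all add: p_def w_def d_def)
  have ee: "\<epsilon>^2 = 1" by (simp add: \<epsilon> power_mult[symmetric] power_even_eq)
  define n where "n = - 2 * \<delta> * p^2 * (- \<epsilon> + (deriv f u)^2)
    - \<epsilon> * \<alpha>^2 * \<beta>^2 * (f u - u * deriv f u)^2"
  have n: "\<epsilon> * n = 2 * \<delta> * p^2 * w - q"
    unfolding n_def w_def q_def using ee by algebra
  have "A4 i \<alpha> \<beta> \<delta> f u = - (n / (p * d))"
    by (simp add: A4_def Let_def \<epsilon>[symmetric] p_def d_def n_def)
  then have A: "- \<epsilon> * A4 i \<alpha> \<beta> \<delta> f u = (2 * \<delta> * p^2 * w - q) / (p * d)"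
    by (simp add: n[symmetric])
  have "q * w + p * d * s = 2 * \<delta> * p^2 * w^2 \<longleftrightarrow> s * (p * d) = (2 * \<delta> * p^2 * w - q) * w"
    by (auto simp: algebra_simps power2_eq_square)
  also have "\<dots> \<longleftrightarrow> s / w = (2 * \<delta> * p^2 * w - q) / (p * d)"
    using nz by (simp add: frac_eq_eq)
  finally show ?thesis unfolding A by (simp add: p_def w_def d_def q_def s_def)
qed

lemma DERIV_ln_mobius:
  assumes h: "(h has_real_derivative h') (at u)" and "1 - (h u)^2 > 0"
  shows "((\<lambda>s. ln ((1 - h s) / (1 + h s))) has_real_derivative - 2 * (h' / (1 - (h u)^2))) (at u)"
proof -
  have "\<bar>h u\<bar> < 1" using assms(2) by (simp add: abs_square_less_1)
  then have b: "1 - h u > 0" "1 + h u > 0" by auto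
  have w: "1 - (h u)^2 = (1 - h u) * (1 + h u)" by algebra
  show ?thesis
    unfolding w using b
    by (auto intro!: derivative_eq_intros h simp: divide_simps power2_eq_square)
      (simp add: algebra_simps)
qed

text \<open>By uniqueness of derivatives, asserting that the angle has a given derivative amounts to
  comparing that value with the one from the chain rule. Both angles yield the same equation
  because \<open>- \<epsilon>\<close> is \<open>1\<close> for the Euclidean and \<open>-1\<close> for the hyperbolic one, the latter matching the
  decreasing function \<open>(1 - x) / (1 + x)\<close>.\<close>

lemma solves_meridian_ode_iff:
  assumes i: "i \<in> {1, 2}" and f: "smooth_fun_on J f" and \<epsilon>: "\<epsilon> = (-1)^i"
    and W: "\<And>u. u \<in> J \<Longrightarrow> 1 - \<epsilon> * (deriv f u)^2 > 0"
  shows "solves_meridian_ode i \<alpha> \<beta> \<delta> f J \<longleftrightarrow>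
    (\<forall>u\<in>J. deriv (deriv f) u / (1 - \<epsilon> * (deriv f u)^2) = - \<epsilon> * A4 i \<alpha> \<beta> \<delta> f u)"
proof -
  have "(if i = 1
      then ((\<lambda>s. arctan (deriv f s)) has_real_derivative A4 i \<alpha> \<beta> \<delta> f u) (at u)
      else ((\<lambda>s. ln ((1 - deriv f s) / (1 + deriv f s)))
              has_real_derivative 2 * A4 i \<alpha> \<beta> \<delta> f u) (at u)) \<longleftrightarrow>
    deriv (deriv f) u / (1 - \<epsilon> * (deriv f u)^2) = - \<epsilon> * A4 i \<alpha> \<beta> \<delta> f u" if u: "u \<in> J" for u
  proof (cases "i = 1")
    case True
    have "((\<lambda>s. arctan (deriv f s)) has_real_derivative
        deriv (deriv f) u / (1 + (deriv f u)^2)) (at u)"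
      using smooth_fun_on_DERIV(2)[OF f u]
      by (auto intro!: derivative_eq_intros simp: divide_inverse)
    then show ?thesis using True DERIV_unique by (auto simp: \<epsilon>)
  next
    case False
    then have 2: "i = 2" using i by simp
    have "((\<lambda>s. ln ((1 - deriv f s) / (1 + deriv f s))) has_real_derivative
        - 2 * (deriv (deriv f) u / (1 - (deriv f u)^2))) (at u)"
      using DERIV_ln_mobius[OF smooth_fun_on_DERIV(2)[OF f u]] W[OF u] by (simp add: \<epsilon> 2)
    then have "((\<lambda>s. ln ((1 - deriv f s) / (1 + deriv f s)))
        has_real_derivative 2 * A4 i \<alpha> \<beta> \<delta> f u) (at u) \<longleftrightarrow>
      - 2 * (deriv (deriv f) u / (1 - (deriv f u)^2)) = 2 * A4 i \<alpha> \<beta> \<delta> f u"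
      by (auto dest: DERIV_unique)
    then show ?thesis using 2 by (auto simp: \<epsilon>)
  qed
  then show ?thesis unfolding solves_meridian_ode_def by blast
qed

theorem theorem10:
  fixes i :: nat and \<alpha> \<beta> l1 l2 l3 l4 \<delta> :: real
    and f g :: "real \<Rightarrow> real" and J :: "real set"
  assumes "i \<in> {1, 2}"
    and "\<alpha> > 0" and "\<beta> > 0"
    and "\<not> (l1 = 0 \<and> l2 = 0 \<and> l3 = 0 \<and> l4 = 0)"
    and "\<delta> = l1 + l2 + l3 - l4"
    and "timelike_rot_data i \<alpha> \<beta> f g J"
    and "\<forall>u\<in>J. g u = u"
    and A4_defined: "\<forall>u\<in>J. \<alpha>^2 * f u + u * \<beta>^2 * deriv f u \<noteq> 0"
  shows "weighted_flat (quadratic_log_density l1 l2 l3 l4) (rot_surface i \<alpha> \<beta> f g) J \<longleftrightarrow>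
    same_up_to_parametrization (meridian i f g) J
      (\<lambda>u. if i = 1 then vector [f u, 0, u, 0] else vector [f u, 0, 0, u]) J
    \<and> solves_meridian_ode i \<alpha> \<beta> \<delta> f J"
proof -
  define \<epsilon> :: real where "\<epsilon> = (-1)^i"
  note signs = timelike_graph_signs[OF assms(1) assms(6) assms(7) _ \<epsilon>_def]
  have f: "smooth_fun_on J f" using assms(6) by (simp add: timelike_rot_data_def)
  have "same_up_to_parametrization (meridian i f g) J
      (\<lambda>u. if i = 1 then vector [f u, 0, u, 0] else vector [f u, 0, 0, u]) J"
    using assms(7) by (intro same_up_to_parametrization_cong) (simp add: meridian_def)
  moreover have "weighted_flat (quadratic_log_density l1 l2 l3 l4) (rot_surface i \<alpha> \<beta> f g) J \<longleftrightarrow>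
      (\<forall>u\<in>J. deriv (deriv f) u / (1 - \<epsilon> * (deriv f u)^2) = - \<epsilon> * A4 i \<alpha> \<beta> \<delta> f u)"
    unfolding weighted_flat_graph_iff[OF assms(1) assms(6) assms(7) \<epsilon>_def assms(5)]
    by (intro ball_cong refl curvature_equation_iff_A4 \<epsilon>_def A4_defined[rule_format])
      (use signs in fastforce)+
  ultimately show ?thesis
    using solves_meridian_ode_iff[OF assms(1) f \<epsilon>_def signs(2)] by blast
qed

end
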